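(* Let $n \ge 1$, let $A \in M_n(\mathbb{C})$ and let $1 \le p < \infty$. Then $$\left(\frac{1}{n}\,\mathrm{Tr}\,\Bigl|A - \Bigl(\frac{1}{n}\mathrm{Tr}\,A\Bigr) I_n\Bigr|^p\right)^{1/p} \;\le\; 2\, b_p^{1/p}\, \min_{\lambda \in \mathbb{C}} \|A - \lambda I_n\| ,$$ where $b_p = \max_{0 \le t \le 1} \bigl(t^p(1-t) + t(1-t)^p\bigr)$.
   Context: $M_n(\mathbb{C})$ is the algebra of $n\times n$ complex matrices, $I_n$ is the identity matrix, $\mathrm{Tr}$ is the usual (unnormalized) trace, and $\|\cdot\|$ is the operator (spectral) norm. For $B \in M_n(\mathbb{C})$, $|B| = (B^*B)^{1/2}$. The number $b_p$ is the largest $p$-th central moment $\mathbb{E}|X-\mathbb{E}X|^p$ of a Bernoulli random variable $X$ with values in $\{0,1\}$. *)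

theory Defs
  imports "HOL-Analysis.Analysis"
begin

definition conj_transpose :: "complex^'n^'m \<Rightarrow> complex^'m^'n" where
  "conj_transpose A = (\<chi> i j. cnj (A $ j $ i))"

definition unitary_matrix :: "complex^'n^'n \<Rightarrow> bool" where
  "unitary_matrix U \<longleftrightarrow>
     conj_transpose U ** U = mat 1 \<and> U ** conj_transpose U = mat 1"

definition real_diag :: "('n \<Rightarrow> real) \<Rightarrow> complex^'n^'n" where
  "real_diag d = (\<chi> i j. if i = j then complex_of_real (d i) else 0)"

text \<open>
  Functional calculus \<open>f(H)\<close> of a Hermitian matrix \<open>H\<close>: apply \<open>f\<close> to the eigenvalues in a unitary
  diagonalisation. The spectral theorem gives such a diagonalisation, and the result does not
  depend on it (lemma \<open>hermitian_fun_eqI\<close>).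
\<close>

definition hermitian_fun :: "(real \<Rightarrow> real) \<Rightarrow> complex^'n^'n \<Rightarrow> complex^'n^'n" where
  "hermitian_fun f H = (THE Q. \<exists>U d. unitary_matrix U \<and>
     H = U ** real_diag d ** conj_transpose U \<and>
     Q = U ** real_diag (\<lambda>i. f (d i)) ** conj_transpose U)"

definition matrix_abs :: "complex^'n^'n \<Rightarrow> complex^'n^'n" where
  "matrix_abs B = hermitian_fun sqrt (conj_transpose B ** B)"

text \<open>Only meaningful for positive semidefinite \<open>P\<close>, since \<open>powr\<close> is meant for nonnegative bases.\<close>

definition matrix_powr :: "complex^'n^'n \<Rightarrow> real \<Rightarrow> complex^'n^'n" where
  "matrix_powr P p = hermitian_fun (\<lambda>x. x powr p) P"

text \<open>The norm of \<^typ>\<open>complex^'n\<close> is the Euclidean one, so this is the spectral norm.\<close>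

definition operator_norm :: "complex^'n^'n \<Rightarrow> real" where
  "operator_norm A = onorm (\<lambda>v. A *v v)"

definition bernoulli_moment :: "real \<Rightarrow> real \<Rightarrow> real" where
  "bernoulli_moment p t = t powr p * (1 - t) + t * (1 - t) powr p"

text \<open>
  The supremum and the infimum below are attained: see \<open>max_bernoulli_moment_attained\<close> and
  \<open>scalar_dist_attained\<close>.
\<close>

definition max_bernoulli_moment :: "real \<Rightarrow> real" where
  "max_bernoulli_moment p = (SUP t\<in>{0..1}. bernoulli_moment p t)"

definition scalar_dist :: "complex^'n^'n \<Rightarrow> real" where
  "scalar_dist A = (INF c. operator_norm (A - mat c))"

lemma real_diag_mult_right:
  "(W ** real_diag d) $ i $ j = W $ i $ j * complex_of_real (d j)"
proof -
  have "(W ** real_diag d) $ i $ j =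
      (\<Sum>k\<in>UNIV. if k = j then W $ i $ j * complex_of_real (d j) else 0)"
    unfolding matrix_matrix_mult_def real_diag_def
    by (simp only: vec_lambda_beta, rule sum.cong) auto
  then show ?thesis by simp
qed

lemma real_diag_mult_left:
  "(real_diag d ** W) $ i $ j = complex_of_real (d i) * W $ i $ j"
proof -
  have "(real_diag d ** W) $ i $ j =
      (\<Sum>k\<in>UNIV. if k = i then complex_of_real (d i) * W $ i $ j else 0)"
    unfolding matrix_matrix_mult_def real_diag_def
    by (simp only: vec_lambda_beta, rule sum.cong) auto
  then show ?thesis by simp
qed

lemma hermitian_fun_unique:
  assumes U: "unitary_matrix U" and V: "unitary_matrix V"
    and eq: "U ** real_diag d ** conj_transpose U = V ** real_diag e ** conj_transpose V"
  shows "U ** real_diag (\<lambda>i. f (d i)) ** conj_transpose U =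
         V ** real_diag (\<lambda>i. f (e i)) ** conj_transpose V"
proof -
  define W where "W = conj_transpose V ** U"
  have u: "conj_transpose U ** U = mat 1" "U ** conj_transpose U = mat 1"
    and v: "conj_transpose V ** V = mat 1" "V ** conj_transpose V = mat 1"
    using U V by (auto simp: unitary_matrix_def)
  have "conj_transpose V ** (U ** real_diag d ** conj_transpose U) ** U =
        conj_transpose V ** (V ** real_diag e ** conj_transpose V) ** U"
    by (simp only: eq)
  moreover have "conj_transpose V ** (U ** real_diag d ** conj_transpose U) ** U =
      W ** real_diag d ** (conj_transpose U ** U)"
    by (simp add: W_def matrix_mul_assoc)
  moreover have "conj_transpose V ** (V ** real_diag e ** conj_transpose V) ** U =
      (conj_transpose V ** V) ** real_diag e ** W"
    by (simp add: W_def matrix_mul_assoc)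
  ultimately have W: "W ** real_diag d = real_diag e ** W"
    by (simp add: u v)
  have "W ** real_diag (\<lambda>i. f (d i)) = real_diag (\<lambda>i. f (e i)) ** W"
  proof -
    have "W $ i $ j * complex_of_real (f (d j)) = complex_of_real (f (e i)) * W $ i $ j" for i j
    proof (cases "W $ i $ j = 0")
      case False
      have "W $ i $ j * complex_of_real (d j) = complex_of_real (e i) * W $ i $ j"
        using arg_cong[OF W, of "\<lambda>M. M $ i $ j"]
        by (simp add: real_diag_mult_left real_diag_mult_right)
      with False have "d j = e i" by simp
      then show ?thesis by simp
    qed simp
    then show ?thesis
      by (simp add: vec_eq_iff real_diag_mult_left real_diag_mult_right)
  qed
  then have "V ** (W ** real_diag (\<lambda>i. f (d i))) ** conj_transpose U =
             V ** (real_diag (\<lambda>i. f (e i)) ** W) ** conj_transpose U"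
    by simp
  moreover have "V ** (W ** real_diag (\<lambda>i. f (d i))) ** conj_transpose U =
      (V ** conj_transpose V) ** U ** real_diag (\<lambda>i. f (d i)) ** conj_transpose U"
    by (simp add: W_def matrix_mul_assoc)
  moreover have "V ** (real_diag (\<lambda>i. f (e i)) ** W) ** conj_transpose U =
      V ** real_diag (\<lambda>i. f (e i)) ** conj_transpose V ** (U ** conj_transpose U)"
    by (simp add: W_def matrix_mul_assoc)
  ultimately show ?thesis by (simp add: u v)
qed

lemma hermitian_fun_eqI:
  assumes "unitary_matrix U" "H = U ** real_diag d ** conj_transpose U"
  shows "hermitian_fun f H = U ** real_diag (\<lambda>i. f (d i)) ** conj_transpose U"
  unfolding hermitian_fun_def
proof (rule the_equality)
  show "\<exists>U' d'. unitary_matrix U' \<and> H = U' ** real_diag d' ** conj_transpose U' \<and>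
     U ** real_diag (\<lambda>i. f (d i)) ** conj_transpose U =
     U' ** real_diag (\<lambda>i. f (d' i)) ** conj_transpose U'"
    using assms by blast
next
  fix Q
  assume "\<exists>U' d'. unitary_matrix U' \<and> H = U' ** real_diag d' ** conj_transpose U' \<and>
     Q = U' ** real_diag (\<lambda>i. f (d' i)) ** conj_transpose U'"
  then show "Q = U ** real_diag (\<lambda>i. f (d i)) ** conj_transpose U"
    using assms by (auto intro: hermitian_fun_unique)
qed

lemma max_bernoulli_moment_attained:
  assumes "1 \<le> p"
  shows "\<exists>t\<in>{0..1}. max_bernoulli_moment p = bernoulli_moment p t \<and>
           (\<forall>s\<in>{0..1}. bernoulli_moment p s \<le> bernoulli_moment p t)"
proof -
  have "continuous_on {0..1} (bernoulli_moment p)"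
    unfolding bernoulli_moment_def using assms
    by (intro continuous_intros continuous_on_powr') auto
  then obtain t where t: "t \<in> {0..1}"
      "\<forall>s\<in>{0..1}. bernoulli_moment p s \<le> bernoulli_moment p t"
    using continuous_attains_sup[of "{0..1::real}" "bernoulli_moment p"] by auto
  moreover from t have "max_bernoulli_moment p = bernoulli_moment p t"
    unfolding max_bernoulli_moment_def by (intro cSup_eq_maximum) auto
  ultimately show ?thesis by blast
qed

lemma bounded_linear_matrix_vector_mul_complex:
  "bounded_linear (\<lambda>v. (A :: complex^'n^'m) *v v)"
  by (intro linear_conv_bounded_linear[THEN iffD1] linearI)
     (auto simp: matrix_vector_mult_def vec_eq_iff scaleR_sum_right distrib_left sum.distrib)

lemma mat_mult_vec: "mat c *v (v :: complex^'n) = c *s v"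
proof -
  have "(\<Sum>j\<in>UNIV. (if i = j then c else 0) * v $ j) = c * v $ i" for i
  proof -
    have "(\<Sum>j\<in>UNIV. (if i = j then c else 0) * v $ j) =
        (\<Sum>j\<in>UNIV. if j = i then c * v $ i else 0)"
      by (rule sum.cong) auto
    then show ?thesis by simp
  qed
  then show ?thesis
    by (simp add: vec_eq_iff matrix_vector_mult_def mat_def)
qed

lemma norm_complex_smult: "norm (c *s (v :: complex^'n)) = cmod c * norm v"
  by (simp add: norm_vec_def norm_mult L2_set_right_distrib)

lemma operator_norm_mat: "operator_norm (mat c :: complex^'n^'n) = cmod c"
proof -
  have "operator_norm (mat c :: complex^'n^'n) \<le> cmod c"
    unfolding operator_norm_def
    by (rule onorm_le) (simp add: mat_mult_vec norm_complex_smult)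
  moreover have "cmod c \<le> operator_norm (mat c :: complex^'n^'n)"
  proof -
    let ?v = "axis undefined 1 :: complex^'n"
    have "norm (mat c *v ?v) \<le> operator_norm (mat c :: complex^'n^'n) * norm ?v"
      unfolding operator_norm_def by (rule onorm[OF bounded_linear_matrix_vector_mul_complex])
    then show ?thesis by (simp add: mat_mult_vec norm_complex_smult norm_axis_1)
  qed
  ultimately show ?thesis by simp
qed

lemma operator_norm_triangle:
  "operator_norm (A + B) \<le> operator_norm A + operator_norm B"
  unfolding operator_norm_def matrix_vector_mult_add_rdistrib
  by (intro onorm_triangle bounded_linear_matrix_vector_mul_complex)

lemma operator_norm_uminus: "operator_norm (- A) = operator_norm (A :: complex^'n^'n)"
proof -
  have "(\<lambda>v. (- A) *v v) = (\<lambda>v. - (A *v v))"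
    by (auto simp: fun_eq_iff vec_eq_iff matrix_vector_mult_def sum_negf)
  then show ?thesis by (simp add: operator_norm_def onorm_neg)
qed

lemma operator_norm_diff_mat_lipschitz:
  "\<bar>operator_norm (A - mat x) - operator_norm (A - mat y)\<bar> \<le> cmod (x - y)"
proof -
  have *: "operator_norm (A - mat x) \<le> operator_norm (A - mat y) + cmod (y - x)" for x y
  proof -
    have "A - mat x = (A - mat y) + mat (y - x)"
      by (simp add: vec_eq_iff mat_def)
    then show ?thesis
      using operator_norm_triangle[of "A - mat y" "mat (y - x)"]
      by (simp only: operator_norm_mat)
  qed
  show ?thesis using *[of x y] *[of y x] by (simp add: norm_minus_commute)
qed

lemma scalar_dist_attained:
  fixes A :: "complex^'n^'n"
  shows "\<exists>c. scalar_dist A = operator_norm (A - mat c) \<and>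
           (\<forall>c'. operator_norm (A - mat c) \<le> operator_norm (A - mat c'))"
proof -
  let ?g = "\<lambda>l. operator_norm (A - mat l)"
  have cont: "continuous_on S ?g" for S
  proof (rule continuous_on_subset[OF lipschitz_on_continuous_on])
    show "1-lipschitz_on UNIV ?g"
      using operator_norm_diff_mat_lipschitz[of A]
      by (auto simp: lipschitz_on_def dist_norm)
  qed simp
  define R where "R = 2 * ?g 0"
  have "0 \<le> ?g 0"
    unfolding operator_norm_def
    by (intro onorm_pos_le bounded_linear_matrix_vector_mul_complex)
  then have "cball (0::complex) R \<noteq> {}" by (simp add: R_def)
  then obtain l where l: "l \<in> cball 0 R" "\<And>m. m \<in> cball 0 R \<Longrightarrow> ?g l \<le> ?g m"
    using continuous_attains_inf[OF compact_cball _ cont, of 0 R] by blast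
  have le: "?g l \<le> ?g m" for m
  proof (cases "m \<in> cball 0 R")
    case False
    have A0: "A - mat 0 = A" by (simp add: vec_eq_iff mat_def)
    have "mat m = A + (- (A - mat m))" by simp
    then have "cmod m \<le> operator_norm A + ?g m"
      by (metis operator_norm_mat operator_norm_triangle operator_norm_uminus)
    with False have "?g 0 \<le> ?g m" by (simp add: R_def A0)
    moreover have "?g l \<le> ?g 0" using l(2)[of 0] \<open>0 \<le> ?g 0\<close> by (simp add: R_def)
    ultimately show ?thesis by simp
  qed (use l in auto)
  then have "scalar_dist A = ?g l"
    unfolding scalar_dist_def by (intro cInf_eq_minimum) auto
  with le show ?thesis by blast
qed

end

theory Submission
  imports Defs
begin

text \<open>
  Let \<open>C = A - \<lambda> I\<close> with \<open>\<lambda>\<close> optimal, scaled to \<open>\<parallel>C\<parallel> \<le> 1\<close>, let \<open>m\<close> be its normalised trace, \<open>r = |m|\<close>, and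
  \<open>B = C - m I\<close>, which is the centred \<open>A\<close>. In an orthonormal eigenbasis \<open>(u\<^sub>i)\<close> of \<open>B\<^sup>* B\<close> we have
  \<open>Tr |B|\<^sup>p = \<Sum>\<^sub>i \<parallel>B u\<^sub>i\<parallel>\<^sup>p\<close> and \<open>\<parallel>B u\<^sub>i\<parallel>\<^sup>2 \<le> 1 + r\<^sup>2 - 2 y\<^sub>i\<close>, where the numbers
  \<open>y\<^sub>i = Re (cnj m \<langle>u\<^sub>i, C u\<^sub>i\<rangle>)\<close> lie in \<open>[-r, r]\<close> and have mean \<open>r\<^sup>2\<close>. For \<open>p \<ge> 2\<close> convexity of
  \<open>z \<mapsto> z\<^bsup>p/2\<^esup>\<close> makes the extreme case \<open>y\<^sub>i = \<plusminus>r\<close>, which is the Bernoulli moment at \<open>t = (1 + r)/2\<close>;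
  for \<open>p \<le> 2\<close> concavity bounds the mean of \<open>\<parallel>B u\<^sub>i\<parallel>\<^sup>p\<close> by \<open>1\<close>, which is \<open>2\<^sup>p\<close> times the Bernoulli
  moment at \<open>t = 1/2\<close>.
\<close>

section \<open>The complex inner product and adjoints\<close>

text \<open>Conjugate-linear in the first argument. Its real part is the real inner product
  \<bullet>, through which real Cauchy-Schwarz and orthogonality results carry over.\<close>

definition cdot :: "complex^'n \<Rightarrow> complex^'n \<Rightarrow> complex" where
  "cdot v w = (\<Sum>k\<in>UNIV. cnj (v $ k) * w $ k)"

lemma cdot_add_right: "cdot v (w + x) = cdot v w + cdot v x"
  by (simp add: cdot_def distrib_left sum.distrib)

lemma cdot_smult_right: "cdot v (c *s w) = c * cdot v w"
  by (simp add: cdot_def sum_distrib_left mult.left_commute)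

lemma cdot_commute: "cdot w v = cnj (cdot v w)"
  by (simp add: cdot_def mult.commute)

lemma Re_cdot: "Re (cdot v w) = v \<bullet> w"
  by (simp add: cdot_def inner_vec_def inner_complex_def)

lemma Im_cdot: "Im (cdot v w) = (\<i> *s v) \<bullet> w"
  by (simp add: cdot_def inner_vec_def inner_complex_def algebra_simps)

lemma cdot_self: "cdot v v = complex_of_real ((norm v)\<^sup>2)"
  by (simp add: complex_eq_iff Re_cdot power2_norm_eq_inner Im_cdot)
     (simp add: inner_vec_def inner_complex_def algebra_simps)

text \<open>Unless the product is 0, multiplying \<open>w\<close> by the unimodular scalar
  \<open>s\<close> makes it real and positive, and the real Cauchy-Schwarz inequality
  applies.\<close>

lemma cmod_cdot_le: "cmod (cdot v w) \<le> norm v * norm w"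
proof (cases "cdot v w = 0")
  case False
  define s where "s = cnj (sgn (cdot v w))"
  have "complex_of_real (cmod (cdot v w)) = s * cdot v w"
    using False unfolding s_def sgn_eq
    by (simp add: divide_simps complex_norm_square[symmetric] power2_eq_square mult.commute)
  then have "cmod (cdot v w) = Re (cdot v (s *s w))"
    by (metis Re_complex_of_real cdot_smult_right)
  also have "\<dots> \<le> norm v * norm (s *s w)"
    unfolding Re_cdot by (rule norm_cauchy_schwarz)
  also have "\<dots> = norm v * norm w"
    using False by (simp add: norm_complex_smult s_def norm_sgn)
  finally show ?thesis .
qed simp

lemma cdot_conj_transpose: "cdot v (A *v w) = cdot (conj_transpose A *v v) w"
proof -
  have "cdot v (A *v w) = (\<Sum>k\<in>UNIV. \<Sum>j\<in>UNIV. cnj (v $ k) * (A $ k $ j * w $ j))"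
    by (simp add: cdot_def matrix_vector_mult_def sum_distrib_left)
  also have "\<dots> = (\<Sum>j\<in>UNIV. \<Sum>k\<in>UNIV. cnj (v $ k) * (A $ k $ j * w $ j))"
    by (rule sum.swap)
  also have "\<dots> = cdot (conj_transpose A *v v) w"
    by (simp add: cdot_def matrix_vector_mult_def conj_transpose_def sum_distrib_right
        sum_distrib_left ac_simps)
  finally show ?thesis .
qed

lemma conj_transpose_conj_transpose [simp]: "conj_transpose (conj_transpose A) = A"
  by (simp add: conj_transpose_def vec_eq_iff)

lemma conj_transpose_matrix_mul:
  "conj_transpose (A ** B) = conj_transpose B ** conj_transpose A"
  by (simp add: conj_transpose_def matrix_matrix_mult_def vec_eq_iff mult.commute)

lemma hermitian_inner_commute:
  assumes "conj_transpose H = H"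
  shows "v \<bullet> (H *v w) = (H *v v) \<bullet> w"
  using cdot_conj_transpose[of v H w] assms by (metis Re_cdot)

section \<open>Spectral theorem for Hermitian matrices\<close>

text \<open>Complex orthogonality to \<open>u i\<close> is real orthogonality to both
  \<open>u i\<close> and \<open>\<i> *s u i\<close>. These are at most \<open>2 * card S\<close>
  vectors, fewer than the real dimension \<open>2 * CARD('n)\<close>.\<close>

lemma ex_nonzero_cdot_orthogonal:
  fixes u :: "'n \<Rightarrow> complex^'n"
  assumes "card S < CARD('n)"
  shows "\<exists>w. w \<noteq> 0 \<and> (\<forall>i\<in>S. cdot (u i) w = 0)"
proof -
  let ?T = "u ` S \<union> (\<lambda>i. \<i> *s u i) ` S"
  have "card ?T \<le> card S + card S"
    by (intro card_Un_le[THEN order_trans] add_mono card_image_le) auto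
  then have "dim ?T < DIM(complex^'n)"
    using assms dim_le_card'[of ?T] by simp
  then obtain w where w: "w \<noteq> 0" "\<And>y. y \<in> span ?T \<Longrightarrow> orthogonal w y"
    using orthogonal_to_subspace_exists by blast
  have "cdot (u i) w = 0" if "i \<in> S" for i
  proof -
    have "orthogonal w (u i)" "orthogonal w (\<i> *s u i)"
      using that by (auto intro!: w(2) span_base)
    then show ?thesis
      by (simp add: complex_eq_iff Re_cdot Im_cdot orthogonal_def inner_commute)
  qed
  with w(1) show ?thesis by blast
qed

text \<open>Near \<open>t = 0\<close> a nonzero linear term outweighs the quadratic one. This serves
  as the first-order optimality condition for the Rayleigh quotient.\<close>

lemma linear_coeff_zero_of_nonneg_quadratic:
  fixes a b :: real
  assumes "\<And>t. 0 \<le> t * a + t\<^sup>2 * b"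
  shows "a = 0"
proof (rule ccontr)
  assume "a \<noteq> 0"
  \<comment> \<open>Any \<open>k\<close> above both 0 and \<open>b\<close> works: at
    \<open>t = - a / k\<close> the quadratic equals
    \<open>(a\<^sup>2 / k\<^sup>2) * (b - k)\<close>.\<close>
  define k where "k = \<bar>b\<bar> + 1"
  have k: "k > 0" "b < k" by (auto simp: k_def)
  have "0 \<le> (- a / k) * a + (- a / k)\<^sup>2 * b" by (rule assms)
  also have "\<dots> = (a\<^sup>2 / k\<^sup>2) * (b - k)"
    using k by (simp add: field_simps power2_eq_square)
  also have "\<dots> < 0"
    using k \<open>a \<noteq> 0\<close> by (intro mult_pos_neg) auto
  finally show False by simp
qed

text \<open>A maximiser of the Rayleigh quotient on the orthogonal complement of the eigenvectors found
  so far is again an eigenvector.\<close>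

lemma hermitian_eigenvector_orthogonal:
  fixes H :: "complex^'n^'n" and u :: "'n \<Rightarrow> complex^'n"
  assumes herm: "conj_transpose H = H" and card: "card S < CARD('n)"
    and eig: "\<And>i. i \<in> S \<Longrightarrow> H *v u i = complex_of_real (d i) *s u i"
  obtains v \<mu> where "norm v = 1" "H *v v = complex_of_real \<mu> *s v"
    "\<And>i. i \<in> S \<Longrightarrow> cdot (u i) v = 0"
proof -
  define W where "W = {v. \<forall>i\<in>S. cdot (u i) v = 0}"
  define q where "q v = v \<bullet> (H *v v)" for v
  interpret H: bounded_linear "\<lambda>v. H *v v"
    by (rule bounded_linear_matrix_vector_mul_complex)
  have W_add: "v + w \<in> W" if "v \<in> W" "w \<in> W" for v w
    using that by (simp add: W_def cdot_add_right)
  have W_smult: "c *s v \<in> W" if "v \<in> W" for v c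
    using that by (simp add: W_def cdot_smult_right)
  have scaleR_smult: "a *\<^sub>R v = complex_of_real a *s v" for a and v :: "complex^'n"
    by (simp add: vec_eq_iff complex_eq_iff)
  have W_scaleR: "a *\<^sub>R v \<in> W" if "v \<in> W" for v a
    using W_smult[OF that] by (simp add: scaleR_smult)
  \<comment> \<open>Invariance holds because \<open>H\<close> is Hermitian and maps each
    \<open>u i\<close> to a multiple of itself. It keeps the direction \<open>z\<close> below inside
    \<open>W\<close>.\<close>
  have W_H: "H *v v \<in> W" if "v \<in> W" for v
  proof -
    have "cdot (u i) (H *v v) = 0" if i: "i \<in> S" for i
    proof -
      have "cdot (u i) (H *v v) = cdot (H *v u i) v"
        using cdot_conj_transpose[of "u i" H v] herm by simp
      also have "\<dots> = cnj (complex_of_real (d i) * cdot v (u i))"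
        using eig[OF i] by (metis cdot_commute cdot_smult_right)
      also have "\<dots> = 0"
        using \<open>v \<in> W\<close> i cdot_commute[of v "u i"] by (simp add: W_def)
      finally show ?thesis .
    qed
    then show ?thesis by (simp add: W_def)
  qed
  have "continuous_on UNIV (\<lambda>v. cdot x v)" for x :: "complex^'n"
    unfolding cdot_def by (intro continuous_intros)
  then have "closed (\<Inter>i\<in>S. {v. cdot (u i) v = 0})"
    by (intro closed_INT ballI closed_Collect_eq) auto
  moreover have "W = (\<Inter>i\<in>S. {v. cdot (u i) v = 0})"
    by (auto simp: W_def)
  ultimately have "closed W" by simp
  then have "compact (W \<inter> sphere 0 1)"
    by (simp add: closed_Int_compact)
  moreover obtain w where w: "w \<noteq> 0" "w \<in> W"
    using ex_nonzero_cdot_orthogonal[OF card, of u] unfolding W_def by blast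
  have "(1 / norm w) *\<^sub>R w \<in> W \<inter> sphere 0 1"
    using W_scaleR[OF w(2)] w(1) by simp
  then have "W \<inter> sphere 0 1 \<noteq> {}" by blast
  moreover have "continuous_on (W \<inter> sphere 0 1) q"
    unfolding q_def by (intro continuous_intros H.continuous_on)
  ultimately obtain v where "v \<in> W \<inter> sphere 0 1" "\<forall>x\<in>W \<inter> sphere 0 1. q x \<le> q v"
    using continuous_attains_sup[of "W \<inter> sphere 0 1" q] by blast
  then have v: "v \<in> W" "norm v = 1"
    and vmax: "\<And>x. x \<in> W \<Longrightarrow> norm x = 1 \<Longrightarrow> q x \<le> q v"
    by auto
  define \<mu> where "\<mu> = q v"
  have q_scaleR: "q (a *\<^sub>R x) = a\<^sup>2 * q x" for a x
    by (simp add: q_def H.scaleR power2_eq_square)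
  have q_le: "q x \<le> \<mu> * (x \<bullet> x)" if "x \<in> W" for x
  proof (cases "x = 0")
    case False
    have "q ((1 / norm x) *\<^sub>R x) \<le> \<mu>"
      unfolding \<mu>_def using False W_scaleR[OF that] by (intro vmax) auto
    then show ?thesis
      using False by (simp add: q_scaleR power_one_over divide_simps power2_norm_eq_inner
          mult.commute)
  qed (simp add: q_def)
  \<comment> \<open>\<open>2 *\<^sub>R z\<close> is the gradient at \<open>v\<close> of
    \<open>\<mu> * (x \<bullet> x) - q x\<close>, a function of \<open>x\<close> that is nonnegative
    on \<open>W\<close> and zero at \<open>v\<close>. Moving from \<open>v\<close> along
    \<open>z\<close> stays in \<open>W\<close>, so the linear coefficient
    \<open>2 * (z \<bullet> z)\<close> must vanish.\<close>
  define z where "z = \<mu> *\<^sub>R v - H *v v"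
  have "z \<in> W"
    using W_add[OF W_scaleR[OF v(1), of \<mu>] W_scaleR[OF W_H[OF v(1)], of "-1"]]
    by (simp add: z_def)
  have vv: "v \<bullet> v = 1" using v(2) by (simp add: norm_eq_sqrt_inner)
  have "2 * (z \<bullet> z) = 0"
  proof (rule linear_coeff_zero_of_nonneg_quadratic)
    fix t :: real
    have "q (v + t *\<^sub>R z) \<le> \<mu> * ((v + t *\<^sub>R z) \<bullet> (v + t *\<^sub>R z))"
      by (intro q_le W_add W_scaleR v \<open>z \<in> W\<close>)
    moreover have "v \<bullet> (H *v z) = z \<bullet> (H *v v)"
      using hermitian_inner_commute[OF herm, of v z] by (simp add: inner_commute)
    then have "q (v + t *\<^sub>R z) = \<mu> + 2 * t * (z \<bullet> (H *v v)) + t\<^sup>2 * q z"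
      by (simp add: q_def \<mu>_def H.add H.scaleR inner_add_left inner_add_right power2_eq_square
          algebra_simps)
    moreover have "(v + t *\<^sub>R z) \<bullet> (v + t *\<^sub>R z) = 1 + 2 * t * (z \<bullet> v) + t\<^sup>2 * (z \<bullet> z)"
      using vv by (simp add: inner_add_left inner_add_right power2_eq_square inner_commute)
    ultimately have "0 \<le> t * (2 * (\<mu> * (z \<bullet> v) - z \<bullet> (H *v v))) + t\<^sup>2 * (\<mu> * (z \<bullet> z) - q z)"
      by (simp only:) (simp add: algebra_simps)
    moreover have "\<mu> * (z \<bullet> v) - z \<bullet> (H *v v) = z \<bullet> z"
      by (simp add: z_def inner_diff_right)
    ultimately show "0 \<le> t * (2 * (z \<bullet> z)) + t\<^sup>2 * (\<mu> * (z \<bullet> z) - q z)"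
      by simp
  qed
  then have "H *v v = complex_of_real \<mu> *s v"
    by (simp add: z_def scaleR_smult)
  with v that show ?thesis by (auto simp: W_def)
qed

text \<open>Induction on \<open>S\<close>: each new index receives a unit eigenvector orthogonal to
  the earlier ones. \<open>S = UNIV\<close> yields a full eigenbasis.\<close>

lemma hermitian_orthonormal_eigenvectors:
  fixes H :: "complex^'n^'n"
  assumes herm: "conj_transpose H = H"
  shows "\<exists>(u :: 'n \<Rightarrow> complex^'n) d.
    (\<forall>i\<in>S. \<forall>j\<in>S. cdot (u i) (u j) = (if i = j then 1 else 0)) \<and>
    (\<forall>i\<in>S. H *v u i = complex_of_real (d i) *s u i)"
proof -
  have "finite S" by simp
  then show ?thesis
  proof (induction S)
    case (insert k S)
    then obtain u d where u: "\<And>i j. i \<in> S \<Longrightarrow> j \<in> S \<Longrightarrow> cdot (u i) (u j) = (if i = j then 1 else 0)"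
      and d: "\<And>i. i \<in> S \<Longrightarrow> H *v u i = complex_of_real (d i) *s u i"
      by blast
    have "card S < CARD('n)"
      using \<open>k \<notin> S\<close> by (intro psubset_card_mono) auto
    then obtain v \<mu> where v: "norm v = 1" "H *v v = complex_of_real \<mu> *s v"
      and orth: "\<And>i. i \<in> S \<Longrightarrow> cdot (u i) v = 0"
      using hermitian_eigenvector_orthogonal[OF herm, of S u d] d by blast
    have orth': "cdot v (u i) = 0" if "i \<in> S" for i
      using orth[OF that] cdot_commute[of v "u i"] by simp
    have "cdot v v = 1" by (simp add: cdot_self v)
    then show ?case
      using u d v(2) orth orth' \<open>k \<notin> S\<close>
      by (intro exI[of _ "u(k := v)"] exI[of _ "d(k := \<mu>)"]) auto
  qed simp
qed

text \<open>Translates between matrices and columns: \<open>conj_transpose U ** U = mat 1\<close>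
  becomes orthonormality of the columns of \<open>U\<close>.\<close>

lemma conj_transpose_mult_component:
  "(conj_transpose U ** V) $ i $ j = cdot (column i U) (column j V)"
  by (simp add: matrix_matrix_mult_def conj_transpose_def cdot_def column_def)

lemma column_matrix_mult: "column j (A ** B) = A *v column j B"
  by (simp add: column_def matrix_matrix_mult_def matrix_vector_mult_def vec_eq_iff)

text \<open>With the eigenvectors as columns of \<open>U\<close>, the eigenvalue equations read
  \<open>H ** U = U ** real_diag d\<close>.\<close>

theorem hermitian_diagonalisation:
  fixes H :: "complex^'n^'n"
  assumes "conj_transpose H = H"
  obtains U d where "unitary_matrix U" "H = U ** real_diag d ** conj_transpose U"
proof -
  obtain u :: "'n \<Rightarrow> complex^'n" and d
    where u: "\<And>i j. cdot (u i) (u j) = (if i = j then 1 else 0)"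
      and d: "\<And>i. H *v u i = complex_of_real (d i) *s u i"
    using hermitian_orthonormal_eigenvectors[OF assms, of UNIV] by auto
  define U :: "complex^'n^'n" where "U = (\<chi> k i. u i $ k)"
  have col: "column i U = u i" for i
    by (simp add: U_def column_def vec_eq_iff)
  have "conj_transpose U ** U = mat 1"
    by (simp add: vec_eq_iff conj_transpose_mult_component col u mat_def)
  moreover from this have UU: "U ** conj_transpose U = mat 1"
    by (simp add: matrix_left_right_inverse)
  moreover have "(H ** U) $ k $ i = (U ** real_diag d) $ k $ i" for k i
  proof -
    have "(H ** U) $ k $ i = column i (H ** U) $ k" by (simp add: column_def)
    then show ?thesis
      by (simp add: column_matrix_mult col d real_diag_mult_right) (simp add: U_def mult.commute)
  qed
  then have "H ** U = U ** real_diag d" by (simp add: vec_eq_iff)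
  then have "U ** real_diag d ** conj_transpose U = H ** (U ** conj_transpose U)"
    by (simp add: matrix_mul_assoc)
  ultimately show ?thesis
    using that[of U d] by (simp add: unitary_matrix_def)
qed

section \<open>Traces in an eigenbasis of \<open>conj_transpose B ** B\<close>\<close>

lemma trace_unitary_conjugate:
  assumes "unitary_matrix U"
  shows "trace (U ** A ** conj_transpose U) = trace A"
    and "trace (conj_transpose U ** A ** U) = trace A"
  using assms trace_mul_sym[of "U ** A" "conj_transpose U"] trace_mul_sym[of "conj_transpose U ** A" U]
  by (simp_all add: unitary_matrix_def matrix_mul_assoc)

text \<open>The \<open>u i\<close> are the columns of a unitary diagonalising
  \<open>conj_transpose B ** B\<close>; its eigenvalue at \<open>u i\<close> is the squared norm of
  \<open>B *v u i\<close>. One basis serves every \<open>C\<close> and \<open>p\<close>, so the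
  trace of another matrix can be expanded in it too.\<close>

lemma trace_matrix_abs_powr:
  fixes B :: "complex^'n^'n"
  obtains u :: "'n \<Rightarrow> complex^'n" where
    "\<And>i. norm (u i) = 1"
    "\<And>C. trace C = (\<Sum>i\<in>UNIV. cdot (u i) (C *v u i))"
    "\<And>p. trace (matrix_powr (matrix_abs B) p) =
       complex_of_real (\<Sum>i\<in>UNIV. norm (B *v u i) powr p)"
proof -
  let ?H = "conj_transpose B ** B"
  obtain U d where U: "unitary_matrix U" and H: "?H = U ** real_diag d ** conj_transpose U"
    using hermitian_diagonalisation[of ?H] by (auto simp: conj_transpose_matrix_mul)
  define u where "u i = column i U" for i
  have tr: "trace C = (\<Sum>i\<in>UNIV. cdot (u i) (C *v u i))" for C
  proof -
    have "trace C = trace (conj_transpose U ** (C ** U))"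
      using trace_unitary_conjugate(2)[OF U, of C] by (simp add: matrix_mul_assoc)
    then show ?thesis
      by (simp add: trace_def conj_transpose_mult_component column_matrix_mult u_def)
  qed
  have UU: "conj_transpose U ** U = mat 1" using U by (simp add: unitary_matrix_def)
  have "cdot (u i) (u i) = 1" for i
    using arg_cong[OF UU, of "\<lambda>M. M $ i $ i"]
    by (simp add: conj_transpose_mult_component u_def mat_def)
  then have "complex_of_real ((norm (u i))\<^sup>2) = complex_of_real 1" for i
    unfolding cdot_self by simp
  then have norm_u: "norm (u i) = 1" for i
    unfolding of_real_eq_iff by (simp add: power2_eq_1_iff) (smt (verit) norm_ge_zero)
  have sqrt_d: "sqrt (d i) = norm (B *v u i)" for i
  proof -
    have "conj_transpose U ** ?H ** U = (conj_transpose U ** U) ** real_diag d ** (conj_transpose U ** U)"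
      unfolding H by (simp add: matrix_mul_assoc)
    then have "conj_transpose U ** (?H ** U) = real_diag d"
      by (simp add: UU matrix_mul_assoc)
    then have "complex_of_real (d i) = (conj_transpose U ** (?H ** U)) $ i $ i"
      by (simp add: real_diag_def)
    also have "\<dots> = cdot (u i) (conj_transpose B *v (B *v u i))"
      by (simp add: conj_transpose_mult_component column_matrix_mult u_def
          matrix_vector_mul_assoc)
    also have "\<dots> = complex_of_real ((norm (B *v u i))\<^sup>2)"
      using cdot_conj_transpose[of "u i" "conj_transpose B" "B *v u i"] by (simp add: cdot_self)
    finally have "d i = (norm (B *v u i))\<^sup>2" by (simp only: of_real_eq_iff)
    then show ?thesis by simp
  qed
  have "matrix_abs B = U ** real_diag (\<lambda>i. sqrt (d i)) ** conj_transpose U"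
    unfolding matrix_abs_def by (rule hermitian_fun_eqI[OF U H])
  \<comment> \<open>The same \<open>U\<close> diagonalises \<open>matrix_abs B\<close>, so the
    second functional calculus acts on the values \<open>sqrt (d i)\<close>.\<close>
  then have "matrix_powr (matrix_abs B) p =
      U ** real_diag (\<lambda>i. sqrt (d i) powr p) ** conj_transpose U" for p
    unfolding matrix_powr_def by (rule hermitian_fun_eqI[OF U])
  then have "trace (matrix_powr (matrix_abs B) p) =
      complex_of_real (\<Sum>i\<in>UNIV. norm (B *v u i) powr p)" for p
    by (simp add: trace_unitary_conjugate[OF U] sqrt_d) (simp add: trace_def real_diag_def)
  with norm_u tr that show ?thesis by blast
qed

section \<open>Power inequalities and the Bernoulli moment\<close>

text \<open>For \<open>z > 0\<close> this is weighted AM-GM for \<open>z\<close> and 1 with weights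
  \<open>q\<close> and \<open>1 - q\<close>.\<close>

lemma powr_le_tangent_at_one:
  fixes q z :: real
  assumes "0 < q" "q \<le> 1" "0 \<le> z"
  shows "z powr q \<le> 1 + q * (z - 1)"
proof (cases "z = 0")
  case False
  then show ?thesis
    using Youngs_inequality_0[of q "1 - q" z 1] assms by (simp add: algebra_simps)
qed (use assms in simp)

text \<open>Away from 0 this is \<open>powr_convex\<close>. If an endpoint is 0, what remains is
  \<open>(s * x) powr q \<le> s * x powr q\<close>, which follows from
  \<open>s powr q \<le> s\<close> for \<open>0 < s < 1\<close>.\<close>

lemma convex_on_powr_nonneg:
  fixes q :: real
  assumes "1 \<le> q"
  shows "convex_on {0..} (\<lambda>x. x powr q)"
proof (rule convex_onI)
  have weight_powr_le: "(s * x) powr q \<le> s * x powr q" if "0 < s" "s < 1" "0 \<le> x" for s x :: real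
  proof -
    have "s powr q \<le> s powr 1" using that assms by (intro powr_mono') auto
    then show ?thesis using that by (simp add: powr_mult mult_right_mono)
  qed
  fix t x y :: real
  assume t: "0 < t" "t < 1" and xy: "x \<in> {0..}" "y \<in> {0..}"
  show "((1 - t) *\<^sub>R x + t *\<^sub>R y) powr q \<le> (1 - t) * x powr q + t * y powr q"
  proof (cases "x = 0 \<or> y = 0")
    case True
    then show ?thesis
      using weight_powr_le[of t y] weight_powr_le[of "1 - t" x] t xy assms by auto
  next
    case False
    then show ?thesis
      using convex_onD[OF powr_convex[OF assms], of t x y] t xy by simp
  qed
qed simp

lemma bernoulli_moment_le_max:
  assumes "1 \<le> p" "t \<in> {0..1}"
  shows "bernoulli_moment p t \<le> max_bernoulli_moment p"
  using max_bernoulli_moment_attained[OF assms(1)] assms(2) by auto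

lemma one_le_max_bernoulli_moment:
  assumes "1 \<le> p"
  shows "1 \<le> 2 powr p * max_bernoulli_moment p"
proof -
  have "bernoulli_moment p (1/2) = 1 / 2 powr p"
    by (simp add: bernoulli_moment_def powr_divide)
  then have "1 / 2 powr p \<le> max_bernoulli_moment p"
    using bernoulli_moment_le_max[OF assms, of "1/2"] by simp
  then show ?thesis by (simp add: field_simps)
qed

text \<open>The scalar core of the argument, normalised to norm bound 1: \<open>s i\<close> stands
  for the norm of \<open>B *v u i\<close> and \<open>r\<close> for the modulus of the mean trace of
  \<open>C\<close>.\<close>

lemma sum_powr_le_max_bernoulli_moment:
  fixes s y :: "'n::finite \<Rightarrow> real"
  assumes p: "1 \<le> p" and s0: "\<And>i. 0 \<le> s i" and s: "\<And>i. (s i)\<^sup>2 \<le> 1 + r\<^sup>2 - 2 * y i"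
    and y: "\<And>i. \<bar>y i\<bar> \<le> r" and sum_y: "(\<Sum>i\<in>UNIV. y i) = real CARD('n) * r\<^sup>2"
  shows "(\<Sum>i\<in>UNIV. s i powr p) \<le> real CARD('n) * (2 powr p * max_bernoulli_moment p)"
proof -
  let ?n = "real CARD('n)"
  define q where "q = p / 2"
  define z where "z i = 1 + r\<^sup>2 - 2 * y i" for i
  have q: "0 < q" using p by (simp add: q_def)
  have r0: "0 \<le> r" using y[of undefined] by linarith
  have z0: "0 \<le> z i" for i
    using s[of i] zero_le_power2[of "s i"] unfolding z_def by linarith
  have sq_powr: "x powr p = (x\<^sup>2) powr q" if "0 \<le> x" for x :: real
    using that by (simp add: q_def powr_powr flip: powr_numeral)
  have sz: "s i powr p \<le> z i powr q" for i
    unfolding sq_powr[OF s0] using s[of i] q by (intro powr_mono2) (auto simp: z_def)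
  have sum_z: "(\<Sum>i\<in>UNIV. z i) = ?n * (1 - r\<^sup>2)"
    by (simp add: z_def sum.distrib sum_subtractf sum_y flip: sum_distrib_left)
       (simp add: algebra_simps)
  show ?thesis
  \<comment> \<open>The case \<open>r = 0\<close> is split off because the chord weights below
    divide by \<open>r\<close>; there every \<open>z i\<close> is 1.\<close>
  proof (cases "q \<le> 1 \<or> r = 0")
    case True
    have "(\<Sum>i\<in>UNIV. s i powr p) \<le> ?n"
    proof (cases "q \<le> 1")
      case True
      have "(\<Sum>i\<in>UNIV. s i powr p) \<le> (\<Sum>i\<in>UNIV. 1 + q * (z i - 1))"
        by (intro sum_mono order_trans[OF sz] powr_le_tangent_at_one q True z0)
      also have "\<dots> = ?n - q * (?n * r\<^sup>2)"
        by (simp add: sum.distrib sum_subtractf sum_z algebra_simps flip: sum_distrib_left)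
      also have "\<dots> \<le> ?n" using q by simp
      finally show ?thesis .
    next
      case False
      then have "z i = 1" for i using \<open>q \<le> 1 \<or> r = 0\<close> y[of i] by (simp add: z_def)
      then have "(\<Sum>i\<in>UNIV. s i powr p) \<le> (\<Sum>i\<in>(UNIV :: 'n set). 1)"
        by (intro sum_mono order_trans[OF sz]) simp
      then show ?thesis by simp
    qed
    also have "?n \<le> ?n * (2 powr p * max_bernoulli_moment p)"
      using mult_left_mono[OF one_le_max_bernoulli_moment[OF p], of ?n] by simp
    finally show ?thesis .
  next
    case False
    then have q1: "1 \<le> q" and r: "0 < r" using r0 by auto
    \<comment> \<open>The mean of the \<open>y i\<close> is \<open>r\<^sup>2\<close> and each is at
      most \<open>r\<close>, which forces \<open>r \<le> 1\<close>. Hence \<open>1 - r\<close> is a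
      nonnegative base and \<open>(1 + r) / 2\<close> lies in the unit interval.\<close>
    have "?n * r\<^sup>2 \<le> (\<Sum>i\<in>(UNIV :: 'n set). r)"
      unfolding sum_y[symmetric] using y by (intro sum_mono) (metis abs_le_D1)
    then have r1: "r \<le> 1" using r by (simp add: power2_eq_square)
    \<comment> \<open>\<open>w i\<close> is the weight of the endpoint \<open>y i = - r\<close>,
      where \<open>z i = (1 + r)\<^sup>2\<close>; the endpoint \<open>y i = r\<close> gives
      \<open>(1 - r)\<^sup>2\<close>.\<close>
    define w where "w i = (1 - y i / r) / 2" for i
    have w: "0 \<le> w i" "w i \<le> 1" for i
      using y[of i] r by (auto simp: w_def abs_le_iff field_simps)
    have z_chord: "z i = (1 - w i) * (1 - r)\<^sup>2 + w i * (1 + r)\<^sup>2" for i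
      using r by (simp add: z_def w_def field_simps power2_eq_square)
    have "z i powr q \<le> (1 - w i) * (1 - r) powr p + w i * (1 + r) powr p" for i
      using convex_onD[OF convex_on_powr_nonneg[OF q1] w, of "(1 - r)\<^sup>2" "(1 + r)\<^sup>2" i] r r1
      by (simp add: z_chord sq_powr)
    then have "(\<Sum>i\<in>UNIV. s i powr p) \<le>
        (\<Sum>i\<in>UNIV. (1 - w i) * (1 - r) powr p + w i * (1 + r) powr p)"
      by (intro sum_mono order_trans[OF sz])
    also have "\<dots> = (?n - (\<Sum>i\<in>UNIV. w i)) * (1 - r) powr p + (\<Sum>i\<in>UNIV. w i) * (1 + r) powr p"
      by (simp add: sum.distrib sum_subtractf flip: sum_distrib_right)
    \<comment> \<open>The mean weight depends on \<open>r\<close> alone and equals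
      \<open>1 - t\<close> for \<open>t = (1 + r) / 2\<close>, so the averaged chord bound is a
      multiple of a Bernoulli moment.\<close>
    also have "(\<Sum>i\<in>UNIV. w i) = ?n * ((1 - r) / 2)"
      using r by (simp add: w_def sum_subtractf sum_y power2_eq_square flip: sum_divide_distrib)
        (simp add: algebra_simps)
    also have "(?n - ?n * ((1 - r) / 2)) * (1 - r) powr p + ?n * ((1 - r) / 2) * (1 + r) powr p =
        ?n * (2 powr p * bernoulli_moment p ((1 + r) / 2))"
    proof -
      have half: "1 - (1 + r) / 2 = (1 - r) / 2" by (simp add: field_simps)
      have "((1 + r) / 2) powr p = (1 + r) powr p / 2 powr p"
        "((1 - r) / 2) powr p = (1 - r) powr p / 2 powr p"
        using r r1 by (simp_all add: powr_divide)
      then show ?thesis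
        unfolding bernoulli_moment_def half by (simp add: field_simps)
    qed
    also have "\<dots> \<le> ?n * (2 powr p * max_bernoulli_moment p)"
      using r r1 by (intro mult_left_mono bernoulli_moment_le_max p) auto
    finally show ?thesis .
  qed
qed

section \<open>From the scalar inequality to matrices\<close>

lemma operator_norm_bound: "norm (A *v v) \<le> operator_norm A * norm (v :: complex^'n)"
  unfolding operator_norm_def by (rule onorm[OF bounded_linear_matrix_vector_mul_complex])

lemma trace_abs_powr_centered_le:
  fixes A :: "complex^'n^'n"
  assumes p: "1 \<le> p" and R0: "0 \<le> R" and R: "operator_norm (A - mat c) \<le> R"
  shows "Re (trace (matrix_powr (matrix_abs (A - mat (trace A / of_nat CARD('n)))) p)) / real CARD('n)
    \<le> R powr p * (2 powr p * max_bernoulli_moment p)"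
proof -
  define C where "C = A - mat c"
  define m where "m = trace C / of_nat CARD('n)"
  define B where "B = A - mat (trace A / of_nat CARD('n))"
  have "trace (mat c :: complex^'n^'n) = of_nat CARD('n) * c"
    by (simp add: trace_def mat_def)
  then have "m = trace A / of_nat CARD('n) - c"
    by (simp add: m_def C_def trace_sub diff_divide_distrib)
  \<comment> \<open>Centring is unaffected by subtracting a scalar matrix first, so \<open>B\<close>
    may be studied through \<open>C\<close>, whose norm is at most \<open>R\<close>.\<close>
  then have B: "B = C - mat m"
    by (simp add: B_def C_def vec_eq_iff mat_def)
  obtain u :: "'n \<Rightarrow> complex^'n" where norm_u: "\<And>i. norm (u i) = 1"
    and tr: "\<And>C. trace C = (\<Sum>i\<in>UNIV. cdot (u i) (C *v u i))"
    and abs_powr: "\<And>p. trace (matrix_powr (matrix_abs B) p) =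
       complex_of_real (\<Sum>i\<in>UNIV. norm (B *v u i) powr p)"
    using trace_matrix_abs_powr[of B] by blast
  have norm_C: "norm (C *v u i) \<le> R" for i
    using operator_norm_bound[of C "u i"] R by (simp add: norm_u C_def)
  define y where "y i = Re (cnj m * cdot (u i) (C *v u i))" for i
  have norm_B: "(norm (B *v u i))\<^sup>2 = (norm (C *v u i))\<^sup>2 + (cmod m)\<^sup>2 - 2 * y i" for i
  proof -
    have "B *v u i = C *v u i - m *s u i"
      by (simp add: B matrix_vector_mult_diff_rdistrib mat_mult_vec)
    then have "(norm (B *v u i))\<^sup>2 =
        (norm (C *v u i))\<^sup>2 + (norm (m *s u i))\<^sup>2 - 2 * ((C *v u i) \<bullet> (m *s u i))"
      by (simp add: power2_norm_eq_inner inner_diff_left inner_diff_right inner_commute)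
    moreover have "(C *v u i) \<bullet> (m *s u i) = Re (cnj (m * cdot (C *v u i) (u i)))"
      by (simp add: cdot_smult_right flip: Re_cdot)
    then have "(C *v u i) \<bullet> (m *s u i) = y i"
      by (simp add: y_def cdot_commute[of "u i"])
    ultimately show ?thesis by (simp add: norm_complex_smult norm_u)
  qed
  have y_le: "\<bar>y i\<bar> \<le> R * cmod m" for i
  proof -
    have "\<bar>y i\<bar> \<le> cmod m * cmod (cdot (u i) (C *v u i))"
      unfolding y_def using abs_Re_le_cmod[of "cnj m * cdot (u i) (C *v u i)"]
      by (simp add: norm_mult)
    also have "\<dots> \<le> cmod m * R"
      using cmod_cdot_le[of "u i" "C *v u i"] norm_C[of i]
      by (intro mult_left_mono) (auto simp: norm_u)
    finally show ?thesis by (simp add: mult.commute)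
  qed
  have sum_y: "(\<Sum>i\<in>UNIV. y i) = real CARD('n) * (cmod m)\<^sup>2"
  proof -
    have "(\<Sum>i\<in>UNIV. y i) = Re (cnj m * trace C)"
      by (simp add: y_def tr sum_distrib_left)
    also have "cnj m * trace C = of_nat CARD('n) * (m * cnj m)"
      by (simp add: m_def)
    also have "\<dots> = complex_of_real (real CARD('n) * (cmod m)\<^sup>2)"
      by (simp add: complex_norm_square[symmetric])
    finally show ?thesis by simp
  qed
  have "(\<Sum>i\<in>UNIV. norm (B *v u i) powr p) \<le>
      real CARD('n) * (R powr p * (2 powr p * max_bernoulli_moment p))"
  \<comment> \<open>Rescaling divides by \<open>R\<close>. If \<open>R = 0\<close>, then
    \<open>C\<close> kills the basis, so \<open>m = 0\<close>, every \<open>B *v u i\<close> is 0,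
    and both sides vanish.\<close>
  proof (cases "R = 0")
    case True
    have "trace C = 0" using norm_C True by (simp add: tr cdot_def)
    then have "norm (B *v u i) = 0" for i
      using norm_B[of i] norm_C[of i] True y_le[of i] by (simp add: m_def)
    then show ?thesis using True by simp
  next
    case False
    with R0 have "0 < R" by simp
    \<comment> \<open>Norms and \<open>cmod m\<close> scale by \<open>R\<close>, but
      \<open>y i\<close> scales by \<open>R\<^sup>2\<close>, being a product of \<open>cnj m\<close>
      with a term linear in \<open>C\<close>.\<close>
    have "(\<Sum>i\<in>UNIV. (norm (B *v u i) / R) powr p) \<le>
        real CARD('n) * (2 powr p * max_bernoulli_moment p)"
    proof (rule sum_powr_le_max_bernoulli_moment[OF p, where r = "cmod m / R" and y = "\<lambda>i. y i / R\<^sup>2"])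
      fix i
      have "(norm (B *v u i))\<^sup>2 \<le> R\<^sup>2 + (cmod m)\<^sup>2 - 2 * y i"
        using norm_C[of i] by (simp add: norm_B power_mono)
      then have "(norm (B *v u i))\<^sup>2 / R\<^sup>2 \<le> (R\<^sup>2 + (cmod m)\<^sup>2 - 2 * y i) / R\<^sup>2"
        by (intro divide_right_mono) auto
      then show "(norm (B *v u i) / R)\<^sup>2 \<le> 1 + (cmod m / R)\<^sup>2 - 2 * (y i / R\<^sup>2)"
        using \<open>0 < R\<close> by (simp add: power_divide add_divide_distrib diff_divide_distrib)
      show "\<bar>y i / R\<^sup>2\<bar> \<le> cmod m / R"
        using y_le[of i] \<open>0 < R\<close> by (simp add: abs_divide power2_eq_square field_simps)
    qed (use \<open>0 < R\<close> in \<open>auto simp: sum_y power_divide simp flip: sum_divide_distrib\<close>)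
    moreover have "(\<Sum>i\<in>UNIV. norm (B *v u i) powr p) =
        R powr p * (\<Sum>i\<in>UNIV. (norm (B *v u i) / R) powr p)"
      using \<open>0 < R\<close> by (simp add: sum_distrib_left powr_divide)
    ultimately have "(\<Sum>i\<in>UNIV. norm (B *v u i) powr p) \<le>
        R powr p * (real CARD('n) * (2 powr p * max_bernoulli_moment p))"
      by (simp only: mult_left_mono powr_ge_zero)
    then show ?thesis by (simp only: mult.left_commute)
  qed
  then show ?thesis
    unfolding B_def[symmetric] by (simp add: abs_powr pos_divide_le_eq mult.commute)
qed

theorem theorem4:
  fixes A :: "complex^'n^'n" and p :: real
  assumes "1 \<le> p"
  shows "(Re (trace (matrix_powr (matrix_abs (A - mat (trace A / of_nat CARD('n)))) p))
            / real CARD('n)) powr (1 / p)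
         \<le> 2 * max_bernoulli_moment p powr (1 / p) * scalar_dist A"
proof -
  let ?T = "Re (trace (matrix_powr (matrix_abs (A - mat (trace A / of_nat CARD('n)))) p))
            / real CARD('n)"
  let ?R = "scalar_dist A" and ?b = "max_bernoulli_moment p"
  obtain c where c: "?R = operator_norm (A - mat c)"
    using scalar_dist_attained[of A] by blast
  have R0: "0 \<le> ?R"
    unfolding c operator_norm_def
    by (intro onorm_pos_le bounded_linear_matrix_vector_mul_complex)
  \<comment> \<open>The moment at \<open>t = 0\<close> is 0, a lower bound for the maximum. This
    sign and that of \<open>?T\<close> are needed to take the root \<open>1 / p\<close>.\<close>
  have b0: "0 \<le> ?b"
    using bernoulli_moment_le_max[OF assms, of 0] by (simp add: bernoulli_moment_def)
  have "0 \<le> ?T"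
    by (rule trace_matrix_abs_powr[of "A - mat (trace A / of_nat CARD('n))"])
       (simp add: sum_nonneg)
  then have "?T powr (1 / p) \<le> (?R powr p * (2 powr p * ?b)) powr (1 / p)"
    using trace_abs_powr_centered_le[OF assms R0, of A c] c assms by (intro powr_mono2) auto
  also have "\<dots> = 2 * ?b powr (1 / p) * ?R"
    using assms R0 b0 by (simp add: powr_mult powr_powr)
  finally show ?thesis .
qed

end
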